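(* Let $(X,\|\cdot\|)$ be a normed linear space over $\mathbb{K}$ ($\mathbb{K}=\mathbb{R}$ or $\mathbb{C}$). Let $F_k$, $k\in\{1,\dots,m\}$, be bounded linear functionals on $X$, let $x_i\in X$, $i\in\{1,\dots,n\}$, and let $M_{ik}\ge 0$, $i\in\{1,\dots,n\}$, $k\in\{1,\dots,m\}$, be such that $$\|x_i\|-\operatorname{Re}F_k(x_i)\le M_{ik}\quad\text{for each } i\in\{1,\dots,n\},\ k\in\{1,\dots,m\}.$$ Then: (i) $$\sum_{i=1}^n\|x_i\|\le c_\infty\left\|\sum_{i=1}^n x_i\right\|+\frac1m\sum_{k=1}^m\sum_{i=1}^n M_{ik}.$$ (ii) For every $p\ge 1$, $$\sum_{i=1}^n\|x_i\|\le \frac{1}{m^{1/p}}\,c_p\left\|\sum_{i=1}^n x_i\right\|+\frac1m\sum_{k=1}^m\sum_{i=1}^n M_{ik}.$$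
   Context: For the bounded linear functionals $F_1,\dots,F_m$ on $X$: $c_\infty:=\sup_{x\neq 0}\left[\max_{1\le k\le m}\frac{|F_k(x)|}{\|x\|}\right]$, and for $p\in[1,\infty)$, $c_p:=\sup_{x\neq 0}\left[\frac{\sum_{k=1}^m|F_k(x)|^p}{\|x\|^p}\right]^{1/p}$. Here $m,n\ge 1$. *)

theory Defs
  imports Complex_Main
begin

(* Complex normed spaces are modelled as real normed spaces with a compatible complex
   scalar multiplication; the real structure is the restriction of scalars. *)
class complex_normed_vector = real_normed_vector +
  fixes scaleC :: "complex \<Rightarrow> 'a \<Rightarrow> 'a"  (infixr "*\<^sub>C" 75)
  assumes scaleC_add_right: "a *\<^sub>C (x + y) = a *\<^sub>C x + a *\<^sub>C y"
    and scaleC_add_left: "(a + b) *\<^sub>C x = a *\<^sub>C x + b *\<^sub>C x"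
    and scaleC_scaleC: "a *\<^sub>C (b *\<^sub>C x) = (a * b) *\<^sub>C x"
    and scaleC_one: "1 *\<^sub>C x = x"
    and scaleR_scaleC: "r *\<^sub>R x = complex_of_real r *\<^sub>C x"
    and norm_scaleC: "norm (a *\<^sub>C x) = cmod a * norm x"

instantiation complex :: complex_normed_vector
begin

definition scaleC_complex :: "complex \<Rightarrow> complex \<Rightarrow> complex" where
  "scaleC_complex a z = a * z"

instance
  by standard
    (simp_all add: scaleC_complex_def algebra_simps norm_mult scaleR_conv_of_real)

end

definition bounded_complex_functional :: "('a::complex_normed_vector \<Rightarrow> complex) \<Rightarrow> bool" where
  "bounded_complex_functional F \<longleftrightarrow>
     Vector_Spaces.linear (*\<^sub>C) (*) F \<and> (\<exists>B. \<forall>x. cmod (F x) \<le> B * norm x)"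

(* For bounded functionals the suprema below are over sets that are bounded above, so they
   are genuine real suprema as soon as the space is nontrivial. On the trivial space they are
   the unspecified real Sup {}; there they are only ever multiplied by the norm of 0. The
   codomain 'b is the scalar field: real or complex. *)

definition c_infty :: "nat \<Rightarrow> (nat \<Rightarrow> 'a::real_normed_vector \<Rightarrow> 'b::real_normed_field) \<Rightarrow> real" where
  "c_infty m F = (SUP x\<in>{x. x \<noteq> 0}. MAX k\<in>{1..m}. norm (F k x) / norm x)"

definition c_p :: "real \<Rightarrow> nat \<Rightarrow> (nat \<Rightarrow> 'a::real_normed_vector \<Rightarrow> 'b::real_normed_field) \<Rightarrow> real" where
  "c_p p m F =
     (SUP x\<in>{x. x \<noteq> 0}. ((\<Sum>k=1..m. norm (F k x) powr p) / norm x powr p) powr (1 / p))"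

end

theory Submission
  imports Defs "HOL-Analysis.Convex"
begin

text \<open>
  Summing the hypothesis over \<open>i\<close> and using additivity of each functional shows that
  \<open>\<Sum>i. norm (x i)\<close> exceeds \<open>Re (F k s)\<close>, where \<open>s = (\<Sum>i. x i)\<close>, by at most
  \<open>\<Sum>i. M i k\<close>. This holds for every \<open>k\<close>, so it survives averaging over \<open>k\<close>; since
  \<open>Re (F k s) \<le> norm (F k s)\<close>, the whole problem is reduced to bounding the arithmetic mean of the
  numbers \<open>norm (F k s)\<close> at the single vector \<open>s\<close> (lemma \<open>sum_norm_le_mean_functional\<close>).

  For the first estimate, each of these numbers is at most \<open>c_infty m F * norm s\<close>, and so is their mean.
  For the second, the power mean inequality (lemma \<open>arithmetic_mean_le_power_mean\<close>) bounds the mean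
  by \<open>m powr (-1/p)\<close> times the \<open>p\<close>-norm of the family, and that norm is at most \<open>c_p p m F * norm s\<close>.

  Nothing depends on the scalar field except the real-linear functional below \<open>norm (F k s)\<close>: it is
  \<open>F k\<close> itself over the reals and \<open>Re \<circ> F k\<close> over the complex numbers. Both cases are instances of
  one lemma, in which this functional is a parameter \<open>G k\<close>.
\<close>

section \<open>The power mean inequality\<close>

text \<open>
  Dividing by the power mean \<open>Q\<close> reduces the claim to the case \<open>Q = 1\<close>. There it is the sum over
  \<open>k\<close> of the inequality \<open>t \<le> t powr p / p + (1 - 1 / p)\<close>, which is Young's inequality with
  second factor \<open>1\<close>.
\<close>

lemma arithmetic_mean_le_power_mean:
  fixes a :: "'i \<Rightarrow> real" and p :: real
  assumes fin: "finite K" and ne: "K \<noteq> {}" and p: "p \<ge> 1"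
    and nonneg: "\<And>k. k \<in> K \<Longrightarrow> a k \<ge> 0"
  shows "(\<Sum>k\<in>K. a k) / card K \<le> ((\<Sum>k\<in>K. a k powr p) / card K) powr (1 / p)"
proof (cases "(\<Sum>k\<in>K. a k powr p) = 0")
  case True
  then have "\<forall>k\<in>K. a k powr p = 0"
    using fin by (subst (asm) sum_nonneg_eq_0_iff) auto
  then show ?thesis by simp
next
  case False
  define N where "N = real (card K)"
  define T where "T = (\<Sum>k\<in>K. a k powr p)"
  define Q where "Q = (T / N) powr (1 / p)"
  have N: "N > 0" using fin ne by (simp add: N_def card_gt_0_iff)
  have "T \<ge> 0" unfolding T_def by (intro sum_nonneg) simp
  with False have T: "T > 0" by (simp add: T_def)
  have Q: "Q > 0" using T N by (simp add: Q_def)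
  have Qp: "Q powr p = T / N" using T N p by (simp add: Q_def powr_powr)
  have young: "t \<le> t powr p / p + (1 - 1 / p)" if "t \<ge> 0" for t :: real
  proof (cases "t = 0")
    case True
    then show ?thesis using p by (simp add: field_simps)
  next
    case False
    with that have "t > 0" by simp
    with p Youngs_inequality_0[of "1 / p" "1 - 1 / p" "t powr p" 1] show ?thesis
      by (simp add: powr_powr)
  qed
  have "(\<Sum>k\<in>K. a k) / Q = (\<Sum>k\<in>K. a k / Q)" by (simp add: sum_divide_distrib)
  also have "\<dots> \<le> (\<Sum>k\<in>K. (a k / Q) powr p / p + (1 - 1 / p))"
    using nonneg Q by (intro sum_mono young) auto
  also have "\<dots> = (\<Sum>k\<in>K. a k powr p) / Q powr p / p + N * (1 - 1 / p)"
    by (simp add: sum.distrib powr_divide sum_divide_distrib N_def)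
  also have "\<dots> = N"
    using T N p unfolding T_def[symmetric] Qp by (simp add: field_simps)
  finally have "(\<Sum>k\<in>K. a k) / N \<le> Q" using Q N by (simp add: field_simps)
  then show ?thesis by (simp add: Q_def N_def T_def)
qed

section \<open>The constants as operator bounds\<close>

text \<open>
  Boundedness of the functionals makes the set of quotients bounded above; for an unbounded set the
  real supremum would be unrelated to its members. The zero vector is excluded from the supremum, so
  it is treated separately.
\<close>

lemma norm_functional_le_c_infty:
  fixes F :: "nat \<Rightarrow> 'a::real_normed_vector \<Rightarrow> 'b::real_normed_field"
  assumes bounded: "\<And>k. k \<in> {1..m} \<Longrightarrow> \<exists>B. \<forall>x. norm (F k x) \<le> B * norm x"
    and k: "k \<in> {1..m}"
  shows "norm (F k s) \<le> c_infty m F * norm s"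
proof (cases "s = 0")
  case True
  have "F k 0 = 0"
    using bounded[OF k] by (metis mult_zero_right norm_le_zero_iff norm_zero)
  with True show ?thesis by simp
next
  case False
  obtain B where B: "\<And>k x. k \<in> {1..m} \<Longrightarrow> norm (F k x) \<le> B k * norm x"
    using bounded by metis
  let ?f = "\<lambda>x. MAX k\<in>{1..m}. norm (F k x) / norm x"
  have "?f x \<le> (MAX k\<in>{1..m}. B k)" if "x \<noteq> 0" for x
  proof -
    have "norm (F j x) / norm x \<le> (MAX k\<in>{1..m}. B k)" if "j \<in> {1..m}" for j
    proof -
      have "norm (F j x) / norm x \<le> B j"
        using B[OF that, of x] \<open>x \<noteq> 0\<close> by (simp add: divide_le_eq)
      also have "\<dots> \<le> (MAX k\<in>{1..m}. B k)" using that by (intro Max_ge) auto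
      finally show ?thesis .
    qed
    then show ?thesis using k by (subst Max_le_iff) auto
  qed
  then have bdd: "bdd_above (?f ` {x. x \<noteq> 0})" by (intro bdd_aboveI2) auto
  have "norm (F k s) / norm s \<le> ?f s" using k by (intro Max_ge) auto
  also have "\<dots> \<le> c_infty m F"
    unfolding c_infty_def using False bdd by (intro cSUP_upper) auto
  finally show ?thesis using False by (simp add: divide_le_eq)
qed

lemma p_norm_functionals_le_c_p:
  fixes F :: "nat \<Rightarrow> 'a::real_normed_vector \<Rightarrow> 'b::real_normed_field"
  assumes bounded: "\<And>k. k \<in> {1..m} \<Longrightarrow> \<exists>B. \<forall>x. norm (F k x) \<le> B * norm x"
    and p: "p \<ge> 1"
  shows "(\<Sum>k=1..m. norm (F k s) powr p) powr (1 / p) \<le> c_p p m F * norm s"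
proof (cases "s = 0")
  case True
  have "F k 0 = 0" if "k \<in> {1..m}" for k
    using bounded[OF that] by (metis mult_zero_right norm_le_zero_iff norm_zero)
  with True show ?thesis by simp
next
  case False
  obtain B where B: "\<And>k x. k \<in> {1..m} \<Longrightarrow> norm (F k x) \<le> B k * norm x"
    using bounded by metis
  let ?f = "\<lambda>x. ((\<Sum>k=1..m. norm (F k x) powr p) / norm x powr p) powr (1 / p)"
  have "?f x \<le> (\<Sum>k=1..m. B k powr p) powr (1 / p)" if "x \<noteq> 0" for x
  proof -
    have "(\<Sum>k=1..m. norm (F k x) powr p) / norm x powr p
            = (\<Sum>k=1..m. (norm (F k x) / norm x) powr p)"
      by (simp add: sum_divide_distrib powr_divide)
    also have "\<dots> \<le> (\<Sum>k=1..m. B k powr p)"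
      using B that p by (intro sum_mono powr_mono2) (auto simp: divide_le_eq)
    finally show ?thesis
      using p by (intro powr_mono2) (auto intro!: divide_nonneg_nonneg sum_nonneg)
  qed
  then have bdd: "bdd_above (?f ` {x. x \<noteq> 0})" by (intro bdd_aboveI2) auto
  have "(\<Sum>k=1..m. norm (F k s) powr p) powr (1 / p) / norm s = ?f s"
    using p by (simp add: powr_divide powr_powr)
  also have "\<dots> \<le> c_p p m F"
    unfolding c_p_def using False bdd by (intro cSUP_upper) auto
  finally show ?thesis using False by (simp add: divide_le_eq)
qed

section \<open>Reverse triangle inequalities\<close>

text \<open>
  The reverse triangle inequality before any constant enters. Each \<open>k\<close> alone gives such a bound;
  averaging over \<open>k\<close> is what produces the factor \<open>1 / m\<close> in front of the error terms.
\<close>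

lemma sum_norm_le_mean_functional:
  fixes x :: "'i \<Rightarrow> 'a::real_normed_vector" and G :: "'k \<Rightarrow> 'a \<Rightarrow> real"
  assumes "finite K" and "K \<noteq> {}"
    and additive: "\<And>k. k \<in> K \<Longrightarrow> G k (\<Sum>i\<in>I. x i) = (\<Sum>i\<in>I. G k (x i))"
    and defect: "\<And>i k. i \<in> I \<Longrightarrow> k \<in> K \<Longrightarrow> norm (x i) - G k (x i) \<le> M i k"
  shows "(\<Sum>i\<in>I. norm (x i))
    \<le> (\<Sum>k\<in>K. G k (\<Sum>i\<in>I. x i)) / card K + 1 / card K * (\<Sum>k\<in>K. \<Sum>i\<in>I. M i k)"
proof -
  have "(\<Sum>i\<in>I. norm (x i)) \<le> G k (\<Sum>i\<in>I. x i) + (\<Sum>i\<in>I. M i k)" if "k \<in> K" for k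
  proof -
    have "(\<Sum>i\<in>I. norm (x i)) \<le> (\<Sum>i\<in>I. G k (x i) + M i k)"
      using defect[OF _ that] by (intro sum_mono) (simp add: algebra_simps)
    then show ?thesis using additive[OF that] by (simp add: sum.distrib)
  qed
  then have "(\<Sum>k\<in>K. \<Sum>i\<in>I. norm (x i))
      \<le> (\<Sum>k\<in>K. G k (\<Sum>i\<in>I. x i) + (\<Sum>i\<in>I. M i k))"
    by (intro sum_mono)
  moreover have "real (card K) > 0" using assms(1,2) by (simp add: card_gt_0_iff)
  ultimately show ?thesis by (simp add: sum.distrib field_simps)
qed

text \<open>
  Both estimates over both scalar fields at once: \<open>G k\<close> stands for the real part of \<open>F k\<close>.
\<close>

lemma reverse_triangle_inequalities:
  fixes F :: "nat \<Rightarrow> 'a::real_normed_vector \<Rightarrow> 'b::real_normed_field"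
    and G :: "nat \<Rightarrow> 'a \<Rightarrow> real" and x :: "'i \<Rightarrow> 'a"
  assumes m: "m \<ge> 1"
    and bounded: "\<And>k. k \<in> {1..m} \<Longrightarrow> \<exists>B. \<forall>x. norm (F k x) \<le> B * norm x"
    and additive: "\<And>k. k \<in> {1..m} \<Longrightarrow> G k (\<Sum>i\<in>I. x i) = (\<Sum>i\<in>I. G k (x i))"
    and G_le: "\<And>k y. k \<in> {1..m} \<Longrightarrow> G k y \<le> norm (F k y)"
    and defect: "\<And>i k. i \<in> I \<Longrightarrow> k \<in> {1..m} \<Longrightarrow> norm (x i) - G k (x i) \<le> M i k"
  shows "(\<Sum>i\<in>I. norm (x i))
      \<le> c_infty m F * norm (\<Sum>i\<in>I. x i) + 1 / real m * (\<Sum>k=1..m. \<Sum>i\<in>I. M i k)"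
    and "p \<ge> 1 \<Longrightarrow> (\<Sum>i\<in>I. norm (x i))
      \<le> 1 / real m powr (1 / p) * c_p p m F * norm (\<Sum>i\<in>I. x i)
        + 1 / real m * (\<Sum>k=1..m. \<Sum>i\<in>I. M i k)"
proof -
  define s where "s = (\<Sum>i\<in>I. x i)"
  define E where "E = 1 / real m * (\<Sum>k=1..m. \<Sum>i\<in>I. M i k)"
  have "(\<Sum>i\<in>I. norm (x i)) \<le> (\<Sum>k=1..m. G k s) / real m + E"
    using sum_norm_le_mean_functional[of "{1..m}" G x I M] m additive defect
    by (simp add: s_def E_def)
  also have "(\<Sum>k=1..m. G k s) / real m \<le> (\<Sum>k=1..m. norm (F k s)) / real m"
    using G_le by (intro divide_right_mono sum_mono) auto
  finally have mean: "(\<Sum>i\<in>I. norm (x i)) \<le> (\<Sum>k=1..m. norm (F k s)) / real m + E"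
    by simp
  have "(\<Sum>k=1..m. norm (F k s)) \<le> (\<Sum>k=1..m. c_infty m F * norm s)"
    using norm_functional_le_c_infty[where F = F and m = m] bounded by (intro sum_mono) blast
  then have "(\<Sum>k=1..m. norm (F k s)) / real m \<le> c_infty m F * norm s"
    using m by (simp add: divide_le_eq mult.commute)
  with mean show "(\<Sum>i\<in>I. norm (x i))
      \<le> c_infty m F * norm (\<Sum>i\<in>I. x i) + 1 / real m * (\<Sum>k=1..m. \<Sum>i\<in>I. M i k)"
    unfolding s_def E_def by linarith
  show "(\<Sum>i\<in>I. norm (x i))
      \<le> 1 / real m powr (1 / p) * c_p p m F * norm (\<Sum>i\<in>I. x i)
        + 1 / real m * (\<Sum>k=1..m. \<Sum>i\<in>I. M i k)" if p: "p \<ge> 1"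
  proof -
    have "(\<Sum>k=1..m. norm (F k s)) / real m
        \<le> ((\<Sum>k=1..m. norm (F k s) powr p) / real m) powr (1 / p)"
      using arithmetic_mean_le_power_mean[of "{1..m}" p "\<lambda>k. norm (F k s)"] m p by simp
    also have "\<dots> = 1 / real m powr (1 / p) * (\<Sum>k=1..m. norm (F k s) powr p) powr (1 / p)"
      by (simp add: powr_divide)
    also have "\<dots> \<le> 1 / real m powr (1 / p) * (c_p p m F * norm s)"
      using p_norm_functionals_le_c_p[where F = F and m = m and s = s, OF bounded p]
      by (intro mult_left_mono) auto
    finally show ?thesis using mean unfolding s_def E_def by (simp add: mult.assoc)
  qed
qed

lemma bounded_complex_functional_sum:
  assumes "bounded_complex_functional F"
  shows "F (\<Sum>i\<in>I. x i) = (\<Sum>i\<in>I. F (x i))"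
proof -
  interpret Vector_Spaces.linear "(*\<^sub>C)" "(*)" F
    using assms by (simp add: bounded_complex_functional_def)
  show ?thesis by (rule sum)
qed

theorem theorem13:
  fixes m n :: nat
    and M :: "nat \<Rightarrow> nat \<Rightarrow> real"
  assumes "m \<ge> 1" and "n \<ge> 1"
    and "\<forall>i\<in>{1..n}. \<forall>k\<in>{1..m}. M i k \<ge> 0"
  shows
    "(\<forall>(F :: nat \<Rightarrow> 'a::real_normed_vector \<Rightarrow> real) (x :: nat \<Rightarrow> 'a).
        (\<forall>k\<in>{1..m}. bounded_linear (F k)) \<longrightarrow>
        (\<forall>i\<in>{1..n}. \<forall>k\<in>{1..m}. norm (x i) - F k (x i) \<le> M i k) \<longrightarrow>
        (\<Sum>i=1..n. norm (x i))
          \<le> c_infty m F * norm (\<Sum>i=1..n. x i)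
            + 1 / real m * (\<Sum>k=1..m. \<Sum>i=1..n. M i k) \<and>
        (\<forall>p\<ge>1. (\<Sum>i=1..n. norm (x i))
          \<le> 1 / real m powr (1 / p) * c_p p m F * norm (\<Sum>i=1..n. x i)
            + 1 / real m * (\<Sum>k=1..m. \<Sum>i=1..n. M i k)))
     \<and>
     (\<forall>(F :: nat \<Rightarrow> 'b::complex_normed_vector \<Rightarrow> complex) (x :: nat \<Rightarrow> 'b).
        (\<forall>k\<in>{1..m}. bounded_complex_functional (F k)) \<longrightarrow>
        (\<forall>i\<in>{1..n}. \<forall>k\<in>{1..m}. norm (x i) - Re (F k (x i)) \<le> M i k) \<longrightarrow>
        (\<Sum>i=1..n. norm (x i))
          \<le> c_infty m F * norm (\<Sum>i=1..n. x i)
            + 1 / real m * (\<Sum>k=1..m. \<Sum>i=1..n. M i k) \<and>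
        (\<forall>p\<ge>1. (\<Sum>i=1..n. norm (x i))
          \<le> 1 / real m powr (1 / p) * c_p p m F * norm (\<Sum>i=1..n. x i)
            + 1 / real m * (\<Sum>k=1..m. \<Sum>i=1..n. M i k)))"
proof (intro conjI allI impI)
  fix F :: "nat \<Rightarrow> 'a \<Rightarrow> real" and x :: "nat \<Rightarrow> 'a"
  assume F: "\<forall>k\<in>{1..m}. bounded_linear (F k)"
    and defect: "\<forall>i\<in>{1..n}. \<forall>k\<in>{1..m}. norm (x i) - F k (x i) \<le> M i k"
  have bounded: "\<exists>B. \<forall>x. norm (F k x) \<le> B * norm x" if "k \<in> {1..m}" for k
    using F that bounded_linear.bounded[of "F k"] by (metis mult.commute)
  have additive: "F k (\<Sum>i=1..n. x i) = (\<Sum>i=1..n. F k (x i))" if "k \<in> {1..m}" for k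
    using F that by (intro linear_sum bounded_linear.linear) blast
  note bounds = reverse_triangle_inequalities
    [where F = F and G = F and I = "{1..n}" and x = x and M = M, OF \<open>m \<ge> 1\<close> bounded additive]
  show "(\<Sum>i=1..n. norm (x i))
      \<le> c_infty m F * norm (\<Sum>i=1..n. x i) + 1 / real m * (\<Sum>k=1..m. \<Sum>i=1..n. M i k)"
    using defect by (intro bounds(1)) auto
  show "(\<Sum>i=1..n. norm (x i))
      \<le> 1 / real m powr (1 / p) * c_p p m F * norm (\<Sum>i=1..n. x i)
        + 1 / real m * (\<Sum>k=1..m. \<Sum>i=1..n. M i k)" if "p \<ge> 1" for p
    using defect that by (intro bounds(2)) auto
next
  fix F :: "nat \<Rightarrow> 'b \<Rightarrow> complex" and x :: "nat \<Rightarrow> 'b"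
  assume F: "\<forall>k\<in>{1..m}. bounded_complex_functional (F k)"
    and defect: "\<forall>i\<in>{1..n}. \<forall>k\<in>{1..m}. norm (x i) - Re (F k (x i)) \<le> M i k"
  have bounded: "\<exists>B. \<forall>x. norm (F k x) \<le> B * norm x" if "k \<in> {1..m}" for k
    using F that by (auto simp: bounded_complex_functional_def)
  have additive: "Re (F k (\<Sum>i=1..n. x i)) = (\<Sum>i=1..n. Re (F k (x i)))" if "k \<in> {1..m}" for k
    using F that by (simp add: bounded_complex_functional_sum)
  note bounds = reverse_triangle_inequalities
    [where F = F and G = "\<lambda>k y. Re (F k y)" and I = "{1..n}" and x = x and M = M,
      OF \<open>m \<ge> 1\<close> bounded additive]
  show "(\<Sum>i=1..n. norm (x i))
      \<le> c_infty m F * norm (\<Sum>i=1..n. x i) + 1 / real m * (\<Sum>k=1..m. \<Sum>i=1..n. M i k)"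
    using defect by (intro bounds(1)) (auto simp: complex_Re_le_cmod)
  show "(\<Sum>i=1..n. norm (x i))
      \<le> 1 / real m powr (1 / p) * c_p p m F * norm (\<Sum>i=1..n. x i)
        + 1 / real m * (\<Sum>k=1..m. \<Sum>i=1..n. M i k)" if "p \<ge> 1" for p
    using defect that by (intro bounds(2)) (auto simp: complex_Re_le_cmod)
qed

end
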